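(* Let $(\mathfrak g,\cdot_{\mathfrak g})$ be a pre-Lie algebra, $(V;\rho,\mu)$ a representation of it, and $T:V\to\mathfrak g$ a linear map. The following statements are equivalent: (i) $T$ is an $\mathcal O$-operator on $(\mathfrak g,\cdot_{\mathfrak g})$ associated to $(V;\rho,\mu)$; (ii) $N_T=\begin{pmatrix}0&T\\0&0\end{pmatrix}$, i.e. $N_T(x+v)=T(v)$ for $x\in\mathfrak g,v\in V$, is a Nijenhuis operator on the semidirect product pre-Lie algebra $(\mathfrak g\ltimes_{\rho,\mu}V,\star)$; (iii) $\mathcal N_T=\begin{pmatrix}0&T\\0&\mathrm{Id}\end{pmatrix}$, i.e. $\mathcal N_T(x+v)=T(v)+v$ for $x\in\mathfrak g,v\in V$, is a Nijenhuis operator on the semidirect product pre-Lie algebra $(\mathfrak g\ltimes_{\rho,\mu}V,\star)$.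
   Context: $\mathbb K$ is an algebraically closed field of characteristic $0$; vector spaces are finite dimensional over $\mathbb K$. A pre-Lie algebra is a vector space $\mathfrak g$ with a bilinear product $\cdot_{\mathfrak g}$ such that $(x\cdot_{\mathfrak g} y)\cdot_{\mathfrak g} z-x\cdot_{\mathfrak g}(y\cdot_{\mathfrak g} z)$ is symmetric in $x,y$; $[x,y]^c=x\cdot_{\mathfrak g}y-y\cdot_{\mathfrak g}x$ is then a Lie bracket. A representation $(V;\rho,\mu)$ consists of a vector space $V$, a representation $\rho:\mathfrak g\to\mathfrak{gl}(V)$ of the Lie algebra $(\mathfrak g,[\cdot,\cdot]^c)$ and a linear map $\mu:\mathfrak g\to\mathfrak{gl}(V)$ with $\rho(x)\mu(y)-\mu(y)\rho(x)=\mu(x\cdot_{\mathfrak g}y)-\mu(y)\mu(x)$ for all $x,y\in\mathfrak g$. The semidirect product $\mathfrak g\ltimes_{\rho,\mu}V$ is $\mathfrak g\oplus V$ with the pre-Lie product $(x_1+v_1)\star(x_2+v_2)=x_1\cdot_{\mathfrak g}x_2+\rho(x_1)v_2+\mu(x_2)v_1$. A linear map $T:V\to\mathfrak g$ is an $\mathcal O$-operator associated to $(V;\rho,\mu)$ if $T(u)\cdot_{\mathfrak g}T(v)=T\big(\rho(T(u))(v)+\mu(T(v))(u)\big)$ for all $u,v\in V$. A linear map $N$ on a pre-Lie algebra $(\mathfrak a,\cdot)$ is a Nijenhuis operator if $N(x)\cdot N(y)=N\big(N(x)\cdot y+x\cdot N(y)-N(x\cdot y)\big)$ for all $x,y\in\mathfrak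 a$. *)

theory Defs
  imports "HOL-Analysis.Product_Vector" "HOL-Computational_Algebra.Polynomial"
begin

text \<open>
  Vector spaces are types with an explicit scalar multiplication, as in \<^locale>\<open>vector_space\<close>.
  All notions are set up over an arbitrary field and in arbitrary dimension.
  A linear map \<open>\<rho> : \<gg> \<rightarrow> \<gg>\<ll>(V)\<close> is rendered as the bilinear map \<open>(x, v) \<mapsto> \<rho>(x)(v)\<close>, in curried form.
\<close>

definition bilinear_map ::
  "('k::field \<Rightarrow> 'a::ab_group_add \<Rightarrow> 'a) \<Rightarrow> ('k \<Rightarrow> 'b::ab_group_add \<Rightarrow> 'b) \<Rightarrow>
   ('k \<Rightarrow> 'c::ab_group_add \<Rightarrow> 'c) \<Rightarrow> ('a \<Rightarrow> 'b \<Rightarrow> 'c) \<Rightarrow> bool"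
  where "bilinear_map s1 s2 s3 f \<longleftrightarrow>
    (\<forall>x. Vector_Spaces.linear s2 s3 (f x)) \<and> (\<forall>y. Vector_Spaces.linear s1 s3 (\<lambda>x. f x y))"

locale lie_algebra = vector_space scale
  for scale :: "'k::field \<Rightarrow> 'g::ab_group_add \<Rightarrow> 'g" +
  fixes bracket :: "'g \<Rightarrow> 'g \<Rightarrow> 'g"
  assumes bracket_bilinear: "bilinear_map scale scale scale bracket"
    and bracket_alternating: "bracket x x = 0"
    and jacobi: "bracket x (bracket y z) + bracket y (bracket z x) + bracket z (bracket x y) = 0"

locale lie_representation = lie_algebra sg bracket + V: vector_space sV
  for sg :: "'k::field \<Rightarrow> 'g::ab_group_add \<Rightarrow> 'g"
    and bracket :: "'g \<Rightarrow> 'g \<Rightarrow> 'g"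
    and sV :: "'k \<Rightarrow> 'v::ab_group_add \<Rightarrow> 'v" +
  fixes \<rho> :: "'g \<Rightarrow> 'v \<Rightarrow> 'v"
  assumes rho_bilinear: "bilinear_map sg sV sV \<rho>"
    and rho_bracket: "\<rho> (bracket x y) v = \<rho> x (\<rho> y v) - \<rho> y (\<rho> x v)"

locale pre_lie_algebra = vector_space scale
  for scale :: "'k::field \<Rightarrow> 'g::ab_group_add \<Rightarrow> 'g" +
  fixes mul :: "'g \<Rightarrow> 'g \<Rightarrow> 'g"
  assumes mul_bilinear: "bilinear_map scale scale scale mul"
    and left_symmetric:
      "mul (mul x y) z - mul x (mul y z) = mul (mul y x) z - mul y (mul x z)"

definition commutator_bracket :: "('g::ab_group_add \<Rightarrow> 'g \<Rightarrow> 'g) \<Rightarrow> 'g \<Rightarrow> 'g \<Rightarrow> 'g"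
  where "commutator_bracket mul x y = mul x y - mul y x"

locale pre_lie_representation =
  pre_lie_algebra sg mul + lie_representation sg "commutator_bracket mul" sV \<rho>
  for sg :: "'k::field \<Rightarrow> 'g::ab_group_add \<Rightarrow> 'g"
    and mul :: "'g \<Rightarrow> 'g \<Rightarrow> 'g"
    and sV :: "'k \<Rightarrow> 'v::ab_group_add \<Rightarrow> 'v"
    and \<rho> :: "'g \<Rightarrow> 'v \<Rightarrow> 'v" +
  fixes \<mu> :: "'g \<Rightarrow> 'v \<Rightarrow> 'v"
  assumes mu_bilinear: "bilinear_map sg sV sV \<mu>"
    and rho_mu: "\<rho> x (\<mu> y v) - \<mu> y (\<rho> x v) = \<mu> (mul x y) v - \<mu> y (\<mu> x v)"

definition semidirect_mul ::
  "('g \<Rightarrow> 'g \<Rightarrow> 'g) \<Rightarrow> ('g \<Rightarrow> 'v \<Rightarrow> 'v) \<Rightarrow> ('g \<Rightarrow> 'v \<Rightarrow> 'v::ab_group_add) \<Rightarrow>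
   'g \<times> 'v \<Rightarrow> 'g \<times> 'v \<Rightarrow> 'g \<times> 'v"
  where "semidirect_mul mul \<rho> \<mu> = (\<lambda>(x1, v1) (x2, v2). (mul x1 x2, \<rho> x1 v2 + \<mu> x2 v1))"

locale o_operator = pre_lie_representation sg mul sV \<rho> \<mu> + T: Vector_Spaces.linear sV sg T
  for sg :: "'k::field \<Rightarrow> 'g::ab_group_add \<Rightarrow> 'g"
    and mul :: "'g \<Rightarrow> 'g \<Rightarrow> 'g"
    and sV :: "'k \<Rightarrow> 'v::ab_group_add \<Rightarrow> 'v"
    and \<rho> \<mu> :: "'g \<Rightarrow> 'v \<Rightarrow> 'v"
    and T :: "'v \<Rightarrow> 'g" +
  assumes o_identity: "mul (T u) (T v) = T (\<rho> (T u) v + \<mu> (T v) u)"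

locale nijenhuis_operator = pre_lie_algebra scale mul + N: Vector_Spaces.linear scale scale N
  for scale :: "'k::field \<Rightarrow> 'g::ab_group_add \<Rightarrow> 'g"
    and mul :: "'g \<Rightarrow> 'g \<Rightarrow> 'g"
    and N :: "'g \<Rightarrow> 'g" +
  assumes nijenhuis_identity:
    "mul (N x) (N y) = N (mul (N x) y + mul x (N y) - N (mul x y))"


lemma bilinear_mapD:
  assumes "bilinear_map s1 s2 s3 f"
  shows "f (x + x') y = f x y + f x' y" "f x (y + y') = f x y + f x y'"
    "f (x - x') y = f x y - f x' y" "f x (y - y') = f x y - f x y'"
    "f (s1 c x) y = s3 c (f x y)" "f x (s2 c y) = s3 c (f x y)"
proof -
  interpret a: Vector_Spaces.linear s2 s3 "f x" using assms by (auto simp: bilinear_map_def)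
  interpret b: Vector_Spaces.linear s1 s3 "\<lambda>x. f x y" using assms by (auto simp: bilinear_map_def)
  show "f (x + x') y = f x y + f x' y" "f x (y + y') = f x y + f x y'"
    "f (x - x') y = f x y - f x' y" "f x (y - y') = f x y - f x y'"
    "f (s1 c x) y = s3 c (f x y)" "f x (s2 c y) = s3 c (f x y)"
    by (rule a.add b.add a.diff b.diff a.scale b.scale)+
qed

lemma bilinear_mapI:
  assumes "vector_space s1" "vector_space s2" "vector_space s3"
    and "\<And>x x' y. f (x + x') y = f x y + f x' y" "\<And>x y y'. f x (y + y') = f x y + f x y'"
    and "\<And>c x y. f (s1 c x) y = s3 c (f x y)" "\<And>c x y. f x (s2 c y) = s3 c (f x y)"
  shows "bilinear_map s1 s2 s3 f"
proof -
  interpret v1: vector_space s1 by fact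
  interpret v2: vector_space s2 by fact
  interpret v3: vector_space s3 by fact
  show ?thesis unfolding bilinear_map_def by (intro conjI allI; unfold_locales; fact)
qed

lemma (in pre_lie_algebra) lie_algebra_commutator_bracket:
  "lie_algebra scale (commutator_bracket mul)"
proof
  note m = bilinear_mapD[OF mul_bilinear]
  show "bilinear_map scale scale scale (commutator_bracket mul)"
    by (rule bilinear_mapI) (unfold_locales, auto simp: commutator_bracket_def m algebra_simps)
  show "commutator_bracket mul x x = 0" for x by (simp add: commutator_bracket_def)
  show "commutator_bracket mul x (commutator_bracket mul y z) +
      commutator_bracket mul y (commutator_bracket mul z x) +
      commutator_bracket mul z (commutator_bracket mul x y) = 0" (is "?J = 0") for x y z
  proof -
    define L where "L x y z = mul (mul x y) z - mul x (mul y z) -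
      (mul (mul y x) z - mul y (mul x z))" for x y z
    have "?J = - (L x y z + L y z x + L z x y)"
      by (simp add: L_def commutator_bracket_def m algebra_simps)
    also have "\<dots> = 0"
      using left_symmetric by (simp add: L_def)
    finally show ?thesis .
  qed
qed

lemma (in pre_lie_representation) pre_lie_algebra_semidirect:
  "pre_lie_algebra (module_prod.scale sg sV) (semidirect_mul mul \<rho> \<mu>)"
proof -
  interpret P: vector_space_prod sg sV by unfold_locales
  note b = bilinear_mapD[OF mul_bilinear] bilinear_mapD[OF rho_bilinear]
    bilinear_mapD[OF mu_bilinear]
  show ?thesis
  proof
    show "bilinear_map P.scale P.scale P.scale (semidirect_mul mul \<rho> \<mu>)"
      by (rule bilinear_mapI; (unfold_locales)?)
        (auto simp: semidirect_mul_def P.scale_def b algebra_simps)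
    fix p q r :: "'g \<times> 'v"
    obtain x u y v z w where [simp]: "p = (x, u)" "q = (y, v)" "r = (z, w)"
      by (metis surj_pair)
    have mu_mul: "\<mu> (mul a b) t = \<rho> a (\<mu> b t) - \<mu> b (\<rho> a t) + \<mu> b (\<mu> a t)" for a b t
      using rho_mu[of a b t] by (simp add: algebra_simps)
    show "semidirect_mul mul \<rho> \<mu> (semidirect_mul mul \<rho> \<mu> p q) r -
          semidirect_mul mul \<rho> \<mu> p (semidirect_mul mul \<rho> \<mu> q r) =
          semidirect_mul mul \<rho> \<mu> (semidirect_mul mul \<rho> \<mu> q p) r -
          semidirect_mul mul \<rho> \<mu> q (semidirect_mul mul \<rho> \<mu> p r)"
      using left_symmetric[of x y z] rho_bracket[of x y w]
      by (simp add: mu_mul semidirect_mul_def commutator_bracket_def b algebra_simps)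
  qed
qed

end

theory Submission
  imports Defs
begin

text \<open>
  Both \<open>N\<^sub>T\<close> and \<open>\<N>\<^sub>T\<close> belong to the family \<open>N\<^sub>c (x + v) = T v + c v\<close> with \<open>c\<close> a scalar:
  they are the cases \<open>c = 0\<close> and \<open>c = 1\<close>. For \<open>p = x + u\<close> and \<open>q = y + v\<close> put
  \<open>w = \<rho> (T u) v + \<mu> (T v) u\<close>. Then \<open>N\<^sub>c p \<star> N\<^sub>c q = T u \<cdot> T v + c w\<close>. In
  \<open>N\<^sub>c p \<star> q + p \<star> N\<^sub>c q - N\<^sub>c (p \<star> q)\<close> the part of the \<open>V\<close>-component that depends on \<open>x\<close> or \<open>y\<close>
  is \<open>c (\<rho> x v + \<mu> y u)\<close> minus itself, so that this component is \<open>w\<close>. As \<open>N\<^sub>c\<close> sees only the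
  \<open>V\<close>-component, the right-hand side of the Nijenhuis identity is \<open>T w + c w\<close>. The two sides agree
  in \<open>V\<close> for every \<open>T\<close>, and in \<open>\<gg>\<close> their agreement is the defining identity of an \<open>\<O>\<close>-operator.
\<close>

context pre_lie_representation
begin

lemma linear_block_operator:
  assumes "Vector_Spaces.linear sV sg T"
  shows "Vector_Spaces.linear (module_prod.scale sg sV) (module_prod.scale sg sV)
    (\<lambda>(x, v). (T v, sV c v))"
proof -
  interpret T: Vector_Spaces.linear sV sg T by fact
  interpret P: vector_space_prod sg sV by unfold_locales
  show ?thesis
    by unfold_locales
      (auto simp: P.scale_def T.add T.scale V.scale_right_distrib V.scale_left_commute)
qed

text \<open>
  Stated for a single pair of arguments because the right-hand side involves neither \<open>x\<close>, \<open>y\<close>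
  nor \<open>c\<close>: quantifying over all pairs gives the \<open>\<O>\<close>-operator identity for all \<open>u\<close> and \<open>v\<close>,
  for each \<open>c\<close> the same condition.
\<close>

lemma block_operator_nijenhuis_identity_iff:
  fixes T :: "'v \<Rightarrow> 'g" and c :: 'k
  defines "N \<equiv> \<lambda>(x, v). (T v, sV c v)"
  shows "semidirect_mul mul \<rho> \<mu> (N (x, u)) (N (y, v)) =
      N (semidirect_mul mul \<rho> \<mu> (N (x, u)) (y, v) + semidirect_mul mul \<rho> \<mu> (x, u) (N (y, v)) -
        N (semidirect_mul mul \<rho> \<mu> (x, u) (y, v))) \<longleftrightarrow>
    mul (T u) (T v) = T (\<rho> (T u) v + \<mu> (T v) u)"
proof -
  note b = bilinear_mapD[OF rho_bilinear] bilinear_mapD[OF mu_bilinear]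
  have "\<rho> (T u) v + \<mu> y (sV c u) + (\<rho> x (sV c v) + \<mu> (T v) u) - sV c (\<rho> x v + \<mu> y u) =
      \<rho> (T u) v + \<mu> (T v) u"
    by (simp add: b V.scale_right_distrib)
  then show ?thesis
    by (simp add: N_def semidirect_mul_def b V.scale_right_distrib)
qed

lemma o_operator_iff_nijenhuis_block_operator:
  assumes "Vector_Spaces.linear sV sg T"
  shows "o_operator sg mul sV \<rho> \<mu> T \<longleftrightarrow>
    nijenhuis_operator (module_prod.scale sg sV) (semidirect_mul mul \<rho> \<mu>)
      (\<lambda>(x, v). (T v, sV c v))"
proof -
  have "o_operator sg mul sV \<rho> \<mu> T \<longleftrightarrow>
      (\<forall>u v. mul (T u) (T v) = T (\<rho> (T u) v + \<mu> (T v) u))"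
    using assms pre_lie_representation_axioms
    by (auto simp: o_operator_def o_operator_axioms_def)
  also have "\<dots> \<longleftrightarrow> nijenhuis_operator_axioms (semidirect_mul mul \<rho> \<mu>)
      (\<lambda>(x, v). (T v, sV c v))"
    unfolding nijenhuis_operator_axioms_def split_paired_All
      block_operator_nijenhuis_identity_iff by simp
  also have "\<dots> \<longleftrightarrow> nijenhuis_operator (module_prod.scale sg sV) (semidirect_mul mul \<rho> \<mu>)
      (\<lambda>(x, v). (T v, sV c v))"
    using linear_block_operator[OF assms] pre_lie_algebra_semidirect
    by (simp add: nijenhuis_operator_def)
  finally show ?thesis .
qed

end

theorem proposition5p6:
  fixes sg :: "'k::{alg_closed_field, field_char_0} \<Rightarrow> 'g::ab_group_add \<Rightarrow> 'g"
    and sV :: "'k \<Rightarrow> 'v::ab_group_add \<Rightarrow> 'v"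
    and mul :: "'g \<Rightarrow> 'g \<Rightarrow> 'g"
    and \<rho> \<mu> :: "'g \<Rightarrow> 'v \<Rightarrow> 'v"
    and T :: "'v \<Rightarrow> 'g"
  assumes "finite_dimensional_vector_space sg Bg"
    and "finite_dimensional_vector_space sV BV"
    and "pre_lie_algebra sg mul"
    and "pre_lie_representation sg mul sV \<rho> \<mu>"
    and "Vector_Spaces.linear sV sg T"
  shows "(o_operator sg mul sV \<rho> \<mu> T \<longleftrightarrow>
          nijenhuis_operator (module_prod.scale sg sV) (semidirect_mul mul \<rho> \<mu>)
            (\<lambda>(x, v). (T v, 0))) \<and>
         (o_operator sg mul sV \<rho> \<mu> T \<longleftrightarrow>
          nijenhuis_operator (module_prod.scale sg sV) (semidirect_mul mul \<rho> \<mu>)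
            (\<lambda>(x, v). (T v, v)))"
proof -
  interpret pre_lie_representation sg mul sV \<rho> \<mu> by fact
  note iff = o_operator_iff_nijenhuis_block_operator[OF assms(5)]
  show ?thesis
    using iff[of 0] iff[of 1] by simp
qed

end
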